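(* Let $\Pi$ be a valid collocation projection (relative to the polynomial degree $p$) with associated quadrature strength $\tau$ and primary aliasing coefficient $d_\Pi$. If $i,j,k$ are integers with $0\le i,j,k\le p$ and $i+j=\tau-p+2$, then $$\Delta_{ijk}(\alpha,\beta)=0\quad\text{for}\quad \alpha=\frac{\tau-p+2}{\tau+2},\qquad \beta=\frac{p}{\tau+2}.$$ In particular, for the $(p+1)$ Gauss-Legendre nodes (with $\tau=2p+1$) this occurs when $\alpha=\frac{p+3}{2p+3}$, $\beta=\frac{p}{2p+3}$, and for the $(p+1)$ Gauss-Legendre-Lobatto nodes (with $\tau=2p-1$) it occurs when $\alpha=\frac{p+1}{2p+1}$, $\beta=\frac{p}{2p+1}$.
   Context: Let $\Omega=[-1,1]$, let $\Gamma=\partial\Omega=\{-1,1\}$ with outward normal $\hat n$ (so $\hat n(\pm1)=\pm1$ and $\int_\Gamma g\,\hat n\,d\Gamma=g(1)-g(-1)$), let $\mathcal{P}^m$ be the space of polynomials of degree at most $m$, and let $L_i$ be the $i$th Legendre polynomial with $L_i(1)=1$. A collocation projection $\Pi$ with values in $\mathcal{P}^q$ is the interpolation operator at $q+1$ distinct nodes in $\Omega$: $\Pi(f)$ is the unique element of $\mathcal{P}^q$ agreeing with $f$ at the nodes. Given the polynomial degree $p$, $\Pi$ is called valid if (1) its nodes are symmetrically distributed in $\Omega$ (about $0$), and (2) the nodes induce a quadrature rule of strength $\tau\ge 2p-1$ on $\Omega$, i.e. $\int_\Omega f\,d\Omega=\int_\Omega\Pi(f)\,d\Omega$ for all $f\in\mathcal{P}^\tau$.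 The primary aliasing coefficient of $\Pi$ is $d_\Pi:=\int_\Omega\Pi(L_{\tau+1})\,d\Omega$. For $0\le i,j,k\le p$ and real $\alpha,\beta$ with $\alpha+\beta=1$ the aliasing error tensor is $$\Delta_{ijk}(\alpha,\beta):=\int_\Omega \frac{dL_k}{dx}L_iL_j\,d\Omega-\beta\int_\Gamma L_iL_jL_k\,\hat n\,d\Gamma+\int_\Omega\Bigl(\beta\frac{dL_i}{dx}\Pi(L_jL_k)+\beta\frac{dL_j}{dx}\Pi(L_iL_k)-\alpha\frac{dL_k}{dx}\Pi(L_iL_j)\Bigr)d\Omega .$$ The $(p+1)$ Gauss-Legendre nodes are the roots of $L_{p+1}$; the $(p+1)$ Gauss-Legendre-Lobatto nodes ($p\ge1$) are the roots of $(x^2-1)L_p'(x)$. For both, $q=p$.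
   Formalization: The general claim is proved under the added condition p+q ≤ τ+1 or q ≥ 2p (automatic if q ≤ p); without it the claim fails, e.g. p=2, q=3, nodes ±1, ±1/3, τ=3, (i,j,k)=(1,2,2) gives Δ=8/75. *)

theory Defs
  imports "HOL-Analysis.Analysis" "HOL-Computational_Algebra.Polynomial"
begin

(* Rodrigues' formula; this is the normalisation with value 1 at x = 1. *)
definition legendre :: "nat \<Rightarrow> real poly" where
  "legendre n = smult (1 / (2 ^ n * fact n)) ((pderiv ^^ n) ([:-1, 0, 1:] ^ n))"

(* A projection is represented by its node set X; with card X = q + 1 the values
   have degree at most q.  The description is well defined for finite nonempty X. *)
definition collocation :: "real set \<Rightarrow> (real \<Rightarrow> real) \<Rightarrow> real poly" where
  "collocation X f = (THE g. degree g < card X \<and> (\<forall>x\<in>X. poly g x = f x))"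

definition int_dom :: "real poly \<Rightarrow> real" where
  "int_dom f = integral {-1..1} (poly f)"

(* The outward normal is 1 at the point 1 and -1 at the point -1. *)
definition int_bd :: "real poly \<Rightarrow> real" where
  "int_bd f = poly f 1 - poly f (-1)"

(* Exactness on all degrees up to t; t is not required to be the largest such degree. *)
definition quadrature_strength :: "real set \<Rightarrow> nat \<Rightarrow> bool" where
  "quadrature_strength X t \<longleftrightarrow>
     (\<forall>f. degree f \<le> t \<longrightarrow> int_dom f = int_dom (collocation X (poly f)))"

(* The condition 2 * p \<le> t + 1 is t \<ge> 2p - 1 without truncated subtraction. *)
definition valid_collocation :: "nat \<Rightarrow> nat \<Rightarrow> nat \<Rightarrow> real set \<Rightarrow> bool" where
  "valid_collocation p q t X \<longleftrightarrow>
     X \<subseteq> {-1..1} \<and> card X = q + 1 \<and> (\<forall>x\<in>X. - x \<in> X) \<and>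
     2 * p \<le> t + 1 \<and> quadrature_strength X t"

definition aliasing_error ::
    "real set \<Rightarrow> real \<Rightarrow> real \<Rightarrow> nat \<Rightarrow> nat \<Rightarrow> nat \<Rightarrow> real" where
  "aliasing_error X \<alpha> \<beta> i j k =
     (let L = legendre; P = (\<lambda>f. collocation X (poly f)) in
        int_dom (pderiv (L k) * L i * L j)
        - \<beta> * int_bd (L i * L j * L k)
        + int_dom (smult \<beta> (pderiv (L i) * P (L j * L k))
                 + smult \<beta> (pderiv (L j) * P (L i * L k))
                 - smult \<alpha> (pderiv (L k) * P (L i * L j))))"

definition gauss_legendre_nodes :: "nat \<Rightarrow> real set" where
  "gauss_legendre_nodes p = {x. poly (legendre (p + 1)) x = 0}"

(* Meaningful for p \<ge> 1 only: for p = 0 the polynomial vanishes identically. *)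
definition gauss_lobatto_nodes :: "nat \<Rightarrow> real set" where
  "gauss_lobatto_nodes p = {x. poly ([:-1, 0, 1:] * pderiv (legendre p)) x = 0}"

end

theory Submission
  imports Defs
begin

text \<open>
  If \<open>p + q \<le> \<tau> + 1\<close>, the quadrature integrates each product of \<open>L\<^sub>i'\<close> with an interpolant
  exactly, so the three interpolated terms are together the quadrature of
  \<open>F = \<beta> L\<^sub>i' L\<^sub>j L\<^sub>k + \<beta> L\<^sub>j' L\<^sub>i L\<^sub>k - \<alpha> L\<^sub>k' L\<^sub>i L\<^sub>j\<close>. Its degree is at most \<open>\<tau> + 1\<close>, with
  equality possible only for \<open>k = p\<close>, where the leading coefficient is proportional to
  \<open>\<beta> (i + j) - \<alpha> p = 0\<close>. Hence the quadrature of \<open>F\<close> is exact, and without aliasing the error is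
  \<open>\<beta>\<close> times the integral of \<open>(L\<^sub>i L\<^sub>j L\<^sub>k)'\<close> minus its boundary term, which is zero. If \<open>2 p \<le> q\<close>, the
  products are reproduced by the interpolation, and there is no aliasing at all.

  For the two node families, repeated use of Rolle's theorem on \<open>(x\<^sup>2 - 1)\<^sup>n\<close> gives the number of
  nodes, and orthogonality of \<open>L\<^sub>n\<close> to lower degrees gives the quadrature strength.
\<close>

subsection \<open>Integration of polynomials\<close>

lemma poly_integrable: "poly f integrable_on {a..b::real}"
  by (intro integrable_continuous_real continuous_intros)

lemma int_dom_add: "int_dom (f + g) = int_dom f + int_dom g"
proof -
  have "poly (f + g) = (\<lambda>x. poly f x + poly g x)" by auto
  then show ?thesis
    unfolding int_dom_def using integral_add[OF poly_integrable poly_integrable] by metis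
qed

lemma int_dom_smult: "int_dom (smult c f) = c * int_dom f"
proof -
  have "poly (smult c f) = (\<lambda>x. c * poly f x)" by auto
  then show ?thesis
    unfolding int_dom_def by simp
qed

lemma int_dom_diff: "int_dom (f - g) = int_dom f - int_dom g"
  using int_dom_add[of "f - g" g] by simp

lemma int_dom_0 [simp]: "int_dom 0 = 0"
  using int_dom_smult[of 0 0] by simp

lemma int_dom_pderiv: "int_dom (pderiv f) = int_bd f"
proof -
  have "(poly (pderiv f) has_integral (poly f 1 - poly f (- 1))) {-1..1}"
    by (rule fundamental_theorem_of_calculus)
       (auto intro!: DERIV_subset[OF poly_DERIV]
             simp flip: has_real_derivative_iff_has_vector_derivative)
  then show ?thesis
    unfolding int_dom_def int_bd_def by (rule integral_unique)
qed

lemma int_dom_by_parts: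
  "int_dom (pderiv f * g) = int_bd (f * g) - int_dom (f * pderiv g)"
  using int_dom_pderiv[of "f * g"] by (simp add: pderiv_mult int_dom_add mult.commute)

subsection \<open>Interpolation\<close>

lemma poly_eq_0_if_many_roots:
  fixes h :: "real poly"
  assumes "degree h < card X" "\<And>x. x \<in> X \<Longrightarrow> poly h x = 0"
  shows "h = 0"
proof (rule ccontr)
  assume "h \<noteq> 0"
  then have "card X \<le> card {x. poly h x = 0}"
    using assms(2) by (intro card_mono poly_roots_finite) auto
  also have "\<dots> \<le> degree h"
    using \<open>h \<noteq> 0\<close> by (rule card_poly_roots_bound)
  finally show False using assms(1) by simp
qed

lemma interpolating_poly_exists:
  fixes f :: "real \<Rightarrow> real"
  assumes "finite X" "X \<noteq> {}"
  shows "\<exists>g. degree g < card X \<and> (\<forall>x\<in>X. poly g x = f x)"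
  using assms
proof (induction X rule: finite_ne_induct)
  case (singleton a)
  show ?case by (rule exI[of _ "[:f a:]"]) simp
next
  case (insert a X)
  then obtain g where g: "degree g < card X" "\<forall>x\<in>X. poly g x = f x"
    by blast
  define W where "W = (\<Prod>y\<in>X. [:- y, 1:])"
  have W0: "poly W x = 0 \<longleftrightarrow> x \<in> X" for x
    using insert.hyps(1) by (auto simp: W_def poly_prod)
  have degW: "degree W \<le> card X"
    using degree_prod_sum_le[OF insert.hyps(1), of "\<lambda>y. [:- y, 1:]"]
    by (simp add: W_def o_def)
  \<comment> \<open>\<open>W\<close> vanishes on \<open>X\<close> but not at the new point
    \<open>a\<close>, so this multiple of \<open>W\<close> corrects the value at \<open>a\<close>
    and leaves the old values alone.\<close>
  define h where "h = g + smult ((f a - poly g a) / poly W a) W"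
  have "degree h \<le> card X"
    unfolding h_def using g(1) degW
    by (intro degree_add_le) (auto intro: order.trans[OF degree_smult_le])
  moreover have "poly h x = f x" if "x \<in> insert a X" for x
    using that g(2) W0[of x] insert.hyps(3) W0[of a] by (auto simp: h_def)
  ultimately show ?case
    using insert.hyps(1,3) by (intro exI[of _ h]) auto
qed

context
  fixes X :: "real set"
  assumes X: "card X > 0"
begin

lemma collocation_correct:
  "degree (collocation X f) < card X \<and> (\<forall>x\<in>X. poly (collocation X f) x = f x)"
  unfolding collocation_def
proof (rule theI')
  have "finite X" "X \<noteq> {}" using X by (auto simp: card_gt_0_iff)
  then obtain g where g: "degree g < card X \<and> (\<forall>x\<in>X. poly g x = f x)"
    using interpolating_poly_exists by blast
  show "\<exists>!g. degree g < card X \<and> (\<forall>x\<in>X. poly g x = f x)"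
  proof (rule ex1I)
    show "degree g < card X \<and> (\<forall>x\<in>X. poly g x = f x)" by (rule g)
    fix h assume h: "degree h < card X \<and> (\<forall>x\<in>X. poly h x = f x)"
    have "h - g = 0"
      using g h by (intro poly_eq_0_if_many_roots[of _ X]) (auto intro: degree_diff_less)
    then show "h = g" by simp
  qed
qed

lemma degree_collocation: "degree (collocation X f) < card X"
  and poly_collocation: "x \<in> X \<Longrightarrow> poly (collocation X f) x = f x"
  using collocation_correct by auto

lemma collocation_eqI:
  assumes "degree g < card X" "\<And>x. x \<in> X \<Longrightarrow> poly g x = f x"
  shows "collocation X f = g"
proof -
  have "collocation X f - g = 0"
    using assms degree_collocation poly_collocation
    by (intro poly_eq_0_if_many_roots[of _ X]) (auto intro: degree_diff_less)
  then show ?thesis by simp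
qed

lemma collocation_poly: "degree g < card X \<Longrightarrow> collocation X (poly g) = g"
  by (rule collocation_eqI) auto

text \<open>Only nodal values matter, so inside an interpolation a factor may be exchanged for its
  own interpolant.\<close>

lemma collocation_cong: "(\<And>x. x \<in> X \<Longrightarrow> f x = g x) \<Longrightarrow> collocation X f = collocation X g"
  using degree_collocation poly_collocation by (intro collocation_eqI) auto

lemma collocation_add:
  "collocation X (poly (f + g)) = collocation X (poly f) + collocation X (poly g)"
  using degree_collocation poly_collocation
  by (intro collocation_eqI) (auto intro: degree_add_less)

lemma collocation_smult:
  "collocation X (poly (smult c f)) = smult c (collocation X (poly f))"
  using X degree_collocation poly_collocation
  by (intro collocation_eqI) (auto intro: le_less_trans[OF degree_smult_le])

lemma collocation_diff:
  "collocation X (poly (f - g)) = collocation X (poly f) - collocation X (poly g)"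
  using degree_collocation poly_collocation
  by (intro collocation_eqI) (auto intro: degree_diff_less)

text \<open>The interpolant has degree below \<open>card X\<close>, so the product has degree at
  most \<open>t\<close> and is integrated exactly; at the nodes the inner interpolant equals
  \<open>g\<close>. The alternative \<open>f = 0\<close> serves derivatives of constants, whose
  degree 0 would otherwise demand \<open>card X <= t + 1\<close>.\<close>

lemma int_dom_mult_collocation:
  assumes Q: "quadrature_strength X t"
    and deg: "f = 0 \<or> degree f + card X \<le> t + 1"
  shows "int_dom (f * collocation X (poly g)) = int_dom (collocation X (poly (f * g)))"
proof -
  have "degree (f * collocation X (poly g)) \<le> t"
    using deg degree_collocation[of "poly g"] degree_mult_le[of f "collocation X (poly g)"]
    by auto
  then have "int_dom (f * collocation X (poly g))
      = int_dom (collocation X (poly (f * collocation X (poly g))))"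
    using Q by (simp add: quadrature_strength_def)
  also have "collocation X (poly (f * collocation X (poly g))) = collocation X (poly (f * g))"
    by (rule collocation_cong) (simp add: poly_collocation)
  finally show ?thesis .
qed

text \<open>The classical criterion by the nodal polynomial \<open>W\<close>: the interpolation
  error vanishes at the nodes, hence is a multiple of \<open>W\<close>, and orthogonality kills its
  integral.\<close>

lemma quadrature_strengthI:
  assumes roots: "\<And>x. x \<in> X \<Longrightarrow> poly W x = 0" and card: "card X = degree W"
    and orth: "\<And>g. degree W + degree g \<le> t \<Longrightarrow> int_dom (W * g) = 0"
  shows "quadrature_strength X t"
  unfolding quadrature_strength_def
proof (intro allI impI)
  fix f :: "real poly" assume f: "degree f \<le> t"
  define h where "h = f - collocation X (poly f)"
  have "W \<noteq> 0" using X card by auto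
  have h0: "poly h x = 0" if "x \<in> X" for x
    using that by (simp add: h_def poly_collocation)
  have "h mod W = 0"
  proof (rule poly_eq_0_if_many_roots[of _ X])
    show "degree (h mod W) < card X"
      using degree_mod_less[OF \<open>W \<noteq> 0\<close>, of h] X card by auto
    fix x assume "x \<in> X"
    have "poly h x = poly (h div W * W) x + poly (h mod W) x"
      by (metis div_mult_mod_eq poly_add)
    then show "poly (h mod W) x = 0" using h0 roots \<open>x \<in> X\<close> by simp
  qed
  then obtain g where g: "h = W * g" by (metis mod_0_imp_dvd dvdE)
  have "int_dom h = 0"
  proof (cases "h = 0")
    case False
    then have dh: "degree h = degree W + degree g"
      using g by (simp add: degree_mult_eq)
    have "degree h \<le> max (degree f) (degree (collocation X (poly f)))"
      unfolding h_def by (rule degree_diff_le_max)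
    \<comment> \<open>By \<open>dh\<close>, \<open>h\<close> has degree at least
      \<open>card X\<close>, more than the interpolant, so the maximum is attained by
      \<open>f\<close>.\<close>
    then have "degree h \<le> t"
      using f dh degree_collocation[of "poly f"] card by linarith
    then show ?thesis using orth dh g by simp
  qed simp
  then show "int_dom f = int_dom (collocation X (poly f))"
    by (simp add: h_def int_dom_diff)
qed

end

subsection \<open>Legendre polynomials\<close>

text \<open>Each derivative costs at most one factor \<open>w\<close>. The surviving factors make
  boundary terms vanish and provide the endpoint roots for Rolle's theorem.\<close>

lemma higher_pderiv_power_dvd:
  fixes w :: "real poly"
  shows "m \<le> n \<Longrightarrow> w ^ (n - m) dvd (pderiv ^^ m) (w ^ n)"
proof (induction m)
  case (Suc m)
  define k where "k = n - Suc m"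
  have k: "n - m = Suc k" using Suc.prems by (simp add: k_def)
  obtain r where r: "(pderiv ^^ m) (w ^ n) = w ^ Suc k * r"
    using Suc k by (auto elim: dvdE)
  have "pderiv (w ^ Suc k * r)
      = w ^ k * (w * pderiv r + smult (of_nat (Suc k)) (pderiv w * r))"
    by (simp only: pderiv_mult pderiv_power_Suc) (simp add: algebra_simps)
  then show ?case using r by (simp add: k_def[symmetric])
qed simp

lemma higher_pderiv_power_root:
  fixes w :: "real poly"
  assumes "m < n" "poly w x = 0"
  shows "poly ((pderiv ^^ m) (w ^ n)) x = 0"
proof -
  obtain r where r: "(pderiv ^^ m) (w ^ n) = w ^ (n - m) * r"
    using higher_pderiv_power_dvd[of m n w] assms(1) by (auto elim: dvdE)
  show ?thesis using assms by (simp add: r)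
qed

text \<open>Integration by parts moves one derivative at a time onto \<open>g\<close>, whose degree
  is too small to survive them all.\<close>

lemma higher_pderiv_power_orthogonal:
  assumes w: "poly w 1 = 0" "poly w (- 1) = 0"
  shows "m \<le> n \<Longrightarrow> degree g < m \<Longrightarrow> int_dom ((pderiv ^^ m) (w ^ n) * g) = 0"
proof (induction m arbitrary: g)
  case (Suc m)
  define A where "A = (pderiv ^^ m) (w ^ n)"
  have "poly A 1 = 0" "poly A (- 1) = 0"
    using Suc.prems(1) w by (auto simp: A_def intro!: higher_pderiv_power_root)
  then have "int_dom (pderiv A * g) = - int_dom (A * pderiv g)"
    by (simp add: int_dom_by_parts int_bd_def)
  also have "int_dom (A * pderiv g) = 0"
  \<comment> \<open>For \<open>m = 0\<close> the induction hypothesis would ask for a degree below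
    0; here \<open>g\<close> is constant instead.\<close>
  proof (cases "m = 0")
    case True
    then have "pderiv g = 0" using Suc.prems(2) by (simp add: pderiv_eq_0_iff)
    then show ?thesis by simp
  next
    case False
    then show ?thesis using Suc.prems unfolding A_def
      by (intro Suc.IH) (auto simp: degree_pderiv)
  qed
  finally show ?case by (simp add: A_def)
qed simp

lemma legendre_orthogonal: "degree g < n \<Longrightarrow> int_dom (legendre n * g) = 0"
  using higher_pderiv_power_orthogonal[of "[:-1, 0, 1:]" n n g]
  by (simp add: legendre_def int_dom_smult)

lemma degree_legendre [simp]: "degree (legendre n) = n"
  by (simp add: legendre_def degree_higher_pderiv degree_power_eq)

lemma legendre_0 [simp]: "legendre 0 = 1"
  by (simp add: legendre_def)

lemma legendre_nonzero [simp]: "legendre n \<noteq> 0"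
proof (cases n)
  case (Suc m)
  then show ?thesis using degree_legendre[of n] by (metis degree_0 nat.distinct(1))
qed simp

lemma pderiv_parity:
  fixes f :: "real poly"
  assumes "\<And>x. poly f (- x) = s * poly f x"
  shows "poly (pderiv f) (- x) = - s * poly (pderiv f) x"
proof -
  \<comment> \<open>The symmetry becomes a polynomial identity, which the chain rule can
    differentiate.\<close>
  have "pcompose f [:0, -1:] = smult s f"
    by (rule poly_ext) (simp add: poly_pcompose assms)
  then have "pderiv (pcompose f [:0, -1:]) = pderiv (smult s f)" by simp
  then have "poly (pderiv (pcompose f [:0, -1:])) x = poly (pderiv (smult s f)) x" by simp
  then show ?thesis
    by (simp add: pderiv_pcompose pderiv_smult poly_pcompose pderiv_pCons)
qed

lemma higher_pderiv_parity:
  fixes f :: "real poly"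
  assumes "\<And>x. poly f (- x) = poly f x"
  shows "poly ((pderiv ^^ m) f) (- x) = (- 1) ^ m * poly ((pderiv ^^ m) f) x"
proof (induction m arbitrary: x)
  case (Suc m)
  show ?case using pderiv_parity[OF Suc.IH, of x] by simp
qed (simp add: assms)

lemma legendre_parity: "poly (legendre n) (- x) = (- 1) ^ n * poly (legendre n) x"
  using higher_pderiv_parity[of "[:-1, 0, 1:] ^ n" n x] by (simp add: legendre_def)

subsection \<open>Roots\<close>

text \<open>Points are added in increasing order, so each new root of the derivative lies to the
  right of all earlier ones. The strict bounds by \<open>Min S\<close> and \<open>Max S\<close> keep
  the roots distinct.\<close>

lemma rolle_roots:
  fixes f :: "real poly"
  assumes "finite S" "S \<noteq> {}" "\<And>x. x \<in> S \<Longrightarrow> poly f x = 0"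
  shows "\<exists>T. finite T \<and> card S = Suc (card T) \<and> T \<subseteq> {Min S<..<Max S}
    \<and> (\<forall>x\<in>T. poly (pderiv f) x = 0)"
  using assms
proof (induction S rule: finite_linorder_max_induct)
  case (insert b S)
  show ?case
  proof (cases "S = {}")
    case False
    then obtain T where T: "finite T" "card S = Suc (card T)" "T \<subseteq> {Min S<..<Max S}"
        "\<forall>x\<in>T. poly (pderiv f) x = 0"
      using insert by auto
    have ltb: "Max S < b" using insert.hyps False by simp
    moreover have "poly f (Max S) = 0" "poly f b = 0"
      using insert.hyps(1) insert.prems(2) False by auto
    ultimately obtain c where c: "Max S < c" "c < b" "poly (pderiv f) c = 0"
      using poly_MVT[of "Max S" b f] by auto
    have "c \<notin> T" using T(3) c(1) by auto
    have "b \<notin> S" using insert.hyps(2) by auto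
    have mm: "Min S \<le> Max S" using insert.hyps(1) False by simp
    have "Min (insert b S) = Min S" "Max (insert b S) = b"
      using Min_insert[OF insert.hyps(1) False, of b] Max_insert[OF insert.hyps(1) False, of b]
        ltb mm by linarith+
    then have "insert c T \<subseteq> {Min (insert b S)<..<Max (insert b S)}"
      using T(3) c ltb mm by auto
    then show ?thesis
      using T c \<open>c \<notin> T\<close> \<open>b \<notin> S\<close> insert.hyps(1) by (intro exI[of _ "insert c T"]) auto
  qed (auto intro!: exI[of _ "{}"])
qed simp

text \<open>While \<open>m < n\<close>, the \<open>m\<close> interior roots and the two endpoints
  are \<open>m + 2\<close> zeros, and Rolle's theorem yields \<open>m + 1\<close> interior zeros of
  the next derivative.\<close>

lemma higher_pderiv_power_roots:
  fixes w :: "real poly"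
  assumes w: "poly w 1 = 0" "poly w (- 1) = 0"
  shows "m \<le> n \<Longrightarrow> \<exists>T. finite T \<and> card T = m \<and> T \<subseteq> {-1<..<1}
    \<and> (\<forall>x\<in>T. poly ((pderiv ^^ m) (w ^ n)) x = 0)"
proof (induction m)
  case (Suc m)
  then obtain T where T: "finite T" "card T = m" "T \<subseteq> {-1<..<1::real}"
      "\<forall>x\<in>T. poly ((pderiv ^^ m) (w ^ n)) x = 0"
    by auto
  define S where "S = insert (-1) (insert 1 T)"
  have "poly ((pderiv ^^ m) (w ^ n)) x = 0" if "x \<in> S" for x
    using that T(4) Suc.prems w by (auto simp: S_def intro: higher_pderiv_power_root)
  moreover have S: "finite S" "S \<noteq> {}" "card S = m + 2"
  proof -
    have "1 \<notin> T" "-1 \<notin> insert 1 T" using T(3) by auto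
    then show "finite S" "S \<noteq> {}" "card S = m + 2" using T(1,2) by (auto simp: S_def)
  qed
  ultimately obtain T' where T': "finite T'" "card S = Suc (card T')"
      "T' \<subseteq> {Min S<..<Max S}" "\<forall>x\<in>T'. poly (pderiv ((pderiv ^^ m) (w ^ n))) x = 0"
    using rolle_roots[of S "(pderiv ^^ m) (w ^ n)"] by blast
  have "S \<subseteq> {-1..1}" using T(3) by (auto simp: S_def)
  then have "-1 \<le> Min S" "Max S \<le> 1" using S by auto
  then have "T' \<subseteq> {-1<..<1}" using T'(3) by fastforce
  moreover have "card T' = Suc m" using T'(2) S(3) by simp
  moreover have "\<forall>x\<in>T'. poly ((pderiv ^^ Suc m) (w ^ n)) x = 0" using T'(4) by simp
  ultimately show ?case using T'(1) by blast
qed auto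

lemma legendre_roots:
  "\<exists>T. finite T \<and> card T = n \<and> T \<subseteq> {-1<..<1} \<and> (\<forall>x\<in>T. poly (legendre n) x = 0)"
  using higher_pderiv_power_roots[of "[:-1, 0, 1:]" n n] by (simp add: legendre_def)

lemma root_set_eqI:
  fixes W :: "real poly"
  assumes "W \<noteq> 0" "card T = degree W" "\<And>x. x \<in> T \<Longrightarrow> poly W x = 0"
  shows "{x. poly W x = 0} = T"
proof -
  have "T = {x. poly W x = 0}"
    using assms poly_roots_finite[of W] card_poly_roots_bound[of W]
    by (intro card_seteq) auto
  then show ?thesis by simp
qed

subsection \<open>Validity of the two node families\<close>

text \<open>The nodal polynomial has degree \<open>p + 1\<close> and is orthogonal to degrees up to
  \<open>p\<close>, which gives strength \<open>2 * p + 1\<close>.\<close>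

lemma valid_gauss_legendre: "valid_collocation p p (2 * p + 1) (gauss_legendre_nodes p)"
proof -
  obtain T where T: "finite T" "card T = p + 1" "T \<subseteq> {-1<..<1}"
      "\<forall>x\<in>T. poly (legendre (p + 1)) x = 0"
    using legendre_roots by blast
  have X: "gauss_legendre_nodes p = T"
    unfolding gauss_legendre_nodes_def using T by (intro root_set_eqI) auto
  have "quadrature_strength (gauss_legendre_nodes p) (2 * p + 1)"
    using T X by (intro quadrature_strengthI[of _ "legendre (p + 1)"])
      (auto intro!: legendre_orthogonal)
  moreover have "- x \<in> gauss_legendre_nodes p" if "x \<in> gauss_legendre_nodes p" for x
    using that legendre_parity[of "p + 1" x] by (simp add: gauss_legendre_nodes_def)
  moreover have "gauss_legendre_nodes p \<subseteq> {-1..1}" using X T(3) by force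
  ultimately show ?thesis
    using X T(2) by (simp add: valid_collocation_def)
qed

lemma valid_gauss_lobatto:
  assumes "p \<ge> 1"
  shows "valid_collocation p p (2 * p - 1) (gauss_lobatto_nodes p)"
proof -
  define w :: "real poly" where "w = [:-1, 0, 1:]"
  define W where "W = w * pderiv (legendre p)"
  obtain S where S: "finite S" "card S = p" "S \<subseteq> {-1<..<1}"
      "\<forall>x\<in>S. poly (legendre p) x = 0"
    using legendre_roots by blast
  have "S \<noteq> {}" using S assms by auto
  \<comment> \<open>Rolle's theorem between the \<open>p\<close> roots of \<open>legendre p\<close>
    supplies the \<open>p - 1\<close> interior nodes.\<close>
  then obtain T where T: "finite T" "card S = Suc (card T)" "T \<subseteq> {Min S<..<Max S}"
      "\<forall>x\<in>T. poly (pderiv (legendre p)) x = 0"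
    using rolle_roots[of S "legendre p"] S by blast
  have "Min S \<in> S" "Max S \<in> S" using S(1) \<open>S \<noteq> {}\<close> by auto
  then have "-1 < Min S" "Max S < 1" using S(3) by auto
  then have T1: "T \<subseteq> {-1<..<1}" using T(3) by fastforce
  have dL: "pderiv (legendre p) \<noteq> 0" using assms by (simp add: pderiv_eq_0_iff)
  have "w \<noteq> 0" "degree w = 2" by (auto simp: w_def)
  then have degW: "degree W = p + 1" and "W \<noteq> 0"
    using assms dL by (simp_all add: W_def degree_mult_eq degree_pderiv)
  have "1 \<notin> T" "-1 \<notin> insert 1 T" using T1 by auto
  then have card: "card (insert (-1) (insert 1 T)) = p + 1"
    using T(1,2) S(2) by simp
  have nodes: "gauss_lobatto_nodes p = {x. poly W x = 0}"
    by (simp add: gauss_lobatto_nodes_def W_def w_def)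
  also have "\<dots> = insert (-1) (insert 1 T)"
    using \<open>W \<noteq> 0\<close> card degW T(4) by (intro root_set_eqI) (auto simp: W_def w_def)
  finally have X: "gauss_lobatto_nodes p = insert (-1) (insert 1 T)" .
  \<comment> \<open>By parts, the derivative moves from \<open>legendre p\<close> to
    \<open>w * g\<close>; the boundary term vanishes with \<open>w\<close>. The premise gives
    \<open>degree g + 2 <= p\<close>, so orthogonality applies; for \<open>p = 1\<close> it is
    contradictory.\<close>
  have "int_dom (W * g) = 0" if "degree W + degree g \<le> 2 * p - 1" for g
  proof -
    have "degree (pderiv (w * g)) < p"
    proof -
      have "degree (w * g) \<le> degree g + 2"
        using degree_mult_le[of w g] \<open>degree w = 2\<close> by simp
      then show ?thesis using that degW assms by (simp add: degree_pderiv)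
    qed
    then have "int_dom (legendre p * pderiv (w * g)) = 0"
      by (rule legendre_orthogonal)
    moreover have "int_bd (legendre p * (w * g)) = 0"
      by (simp add: int_bd_def w_def)
    moreover have "W * g = pderiv (legendre p) * (w * g)"
      by (simp only: W_def ac_simps)
    ultimately show ?thesis
      using int_dom_by_parts[of "legendre p" "w * g"] by (simp only:)
  qed
  then have "quadrature_strength (gauss_lobatto_nodes p) (2 * p - 1)"
    using card X degW nodes by (intro quadrature_strengthI[of _ W]) auto
  moreover have "- x \<in> gauss_lobatto_nodes p" if "x \<in> gauss_lobatto_nodes p" for x
    using that pderiv_parity[of "legendre p", OF legendre_parity, of x]
    by (auto simp: gauss_lobatto_nodes_def)
  moreover have "gauss_lobatto_nodes p \<subseteq> {-1..1}" using X T1 by force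
  ultimately show ?thesis
    using X card assms by (simp add: valid_collocation_def)
qed

subsection \<open>The aliasing error\<close>

text \<open>Since \<alpha> = 1 - \<beta>, the first integral turns the coefficient of the
  \<open>pderiv c\<close> term into \<beta>, and the product rule completes the derivative of
  \<open>a * b * c\<close>.\<close>

lemma no_aliasing_error:
  assumes "\<alpha> + \<beta> = 1"
  shows "int_dom (pderiv c * a * b) - \<beta> * int_bd (a * b * c)
    + int_dom (smult \<beta> (pderiv a * (b * c)) + smult \<beta> (pderiv b * (a * c))
               - smult \<alpha> (pderiv c * (a * b))) = 0"
proof -
  have "int_bd (a * b * c) = int_dom (pderiv a * (b * c) + pderiv b * (a * c) + pderiv c * (a * b))"
    by (simp add: pderiv_mult algebra_simps flip: int_dom_pderiv)
  then have "int_bd (a * b * c)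
      = int_dom (pderiv a * (b * c)) + int_dom (pderiv b * (a * c)) + int_dom (pderiv c * (a * b))"
    by (simp add: int_dom_add)
  moreover have "\<alpha> = 1 - \<beta>" using assms by simp
  ultimately show ?thesis
    by (simp add: int_dom_add int_dom_diff int_dom_smult mult.assoc) (simp add: algebra_simps)
qed

text \<open>Apart from the factor \<open>degree a\<close>, the value is symmetric in the three
  polynomials, so the top coefficients of the terms of \<open>F\<close> can cancel.\<close>

lemma coeff_pderiv_mult_top:
  fixes a b c :: "'a::{idom, semiring_char_0} poly"
  assumes "degree a + degree b + degree c = Suc n"
  shows "coeff (pderiv a * (b * c)) n
    = of_nat (degree a) * (lead_coeff a * lead_coeff b * lead_coeff c)"
proof (cases "degree a = 0")
  case True
  then show ?thesis by (simp add: pderiv_eq_0_iff[THEN iffD2])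
next
  case False
  then have "b = 0 \<or> c = 0 \<or> n = degree (pderiv a) + degree (b * c)"
    using assms by (cases "b = 0 \<or> c = 0") (auto simp: degree_mult_eq degree_pderiv)
  moreover have "lead_coeff (pderiv a) = of_nat (degree a) * lead_coeff a"
    using False by (simp add: degree_pderiv coeff_pderiv)
  ultimately show ?thesis
    by (auto simp: coeff_mult_degree_sum lead_coeff_mult mult.assoc)
qed

lemma degree_pderiv_mult_le:
  fixes a b c :: "real poly"
  assumes "degree a + degree b + degree c \<le> Suc n"
  shows "degree (pderiv a * (b * c)) \<le> n"
proof (cases "degree a = 0")
  case True
  then show ?thesis by (simp add: pderiv_eq_0_iff[THEN iffD2])
next
  case False
  have "degree (pderiv a * (b * c)) \<le> (degree a - 1) + (degree b + degree c)"
    using degree_mult_le[of "pderiv a" "b * c"] degree_mult_le[of b c]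
    by (simp add: degree_pderiv)
  then show ?thesis using assms False by simp
qed

text \<open>Validity alone does not imply \<open>pq\<close>, which bounds the degrees of the
  interpolated terms or else makes interpolation reproduce the products. Writing \<open>ij\<close>
  additively avoids truncated subtraction.\<close>

lemma aliasing_error_eq_0:
  assumes valid: "valid_collocation p q t X"
    and pq: "p + q \<le> t + 1 \<or> 2 * p \<le> q"
    and le: "i \<le> p" "j \<le> p" "k \<le> p"
    and ij: "i + j + p = t + 2"
  shows "aliasing_error X ((real t - real p + 2) / (real t + 2)) (real p / (real t + 2)) i j k = 0"
proof -
  define \<alpha> where "\<alpha> = (real t - real p + 2) / (real t + 2)"
  define \<beta> where "\<beta> = real p / (real t + 2)"
  define a where "a = legendre i"
  define b where "b = legendre j"
  define c where "c = legendre k"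
  define P where "P = (\<lambda>f. collocation X (poly f))"
  define F where "F = smult \<beta> (pderiv a * (b * c)) + smult \<beta> (pderiv b * (a * c))
      - smult \<alpha> (pderiv c * (a * b))"
  define G where "G = smult \<beta> (pderiv a * P (b * c)) + smult \<beta> (pderiv b * P (a * c))
      - smult \<alpha> (pderiv c * P (a * b))"
  have deg [simp]: "degree a = i" "degree b = j" "degree c = k"
    by (simp_all add: a_def b_def c_def)
  have \<alpha>\<beta>: "\<alpha> + \<beta> = 1" by (simp add: \<alpha>_def \<beta>_def flip: add_divide_distrib)
  have card: "card X = q + 1" and Q: "quadrature_strength X t"
    using valid by (auto simp: valid_collocation_def)
  then have X: "card X > 0" by simp
  have "int_dom G = int_dom F"
  proof (cases "2 * p \<le> q")
    case True
    have "P (legendre m * legendre n) = legendre m * legendre n" if "m \<le> p" "n \<le> p" for m n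
      unfolding P_def using X card True that by (intro collocation_poly) (auto simp: degree_mult_eq)
    then show ?thesis using le by (simp add: F_def G_def a_def b_def c_def)
  next
    case False
    then have pq: "p + q \<le> t + 1" using pq by simp
    have PP: "int_dom (pderiv (legendre m) * P g) = int_dom (P (pderiv (legendre m) * g))"
      if "m \<le> p" for m g
    proof -
      have "pderiv (legendre m) = 0 \<or> degree (pderiv (legendre m)) + card X \<le> t + 1"
        using that pq card by (cases "m = 0") (auto simp: degree_pderiv)
      then show ?thesis
        unfolding P_def using int_dom_mult_collocation[OF X Q] by blast
    qed
    have "P F = smult \<beta> (P (pderiv a * (b * c))) + smult \<beta> (P (pderiv b * (a * c)))
        - smult \<alpha> (P (pderiv c * (a * b)))"
      unfolding P_def F_def
      by (simp only: collocation_add[OF X] collocation_diff[OF X] collocation_smult[OF X])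
    then have GP: "int_dom G = int_dom (P F)"
      using le PP unfolding G_def a_def b_def c_def
      by (simp add: int_dom_add int_dom_diff int_dom_smult)
    \<comment> \<open>Needed twice: with \<open>n = t + 1\<close> for \<open>k = p\<close>, and with
      \<open>n = t\<close> for \<open>k < p\<close>.\<close>
    have degF: "degree F \<le> n" if "i + j + k \<le> Suc n" for n
      unfolding F_def using that
      by (intro degree_diff_le degree_add_le order.trans[OF degree_smult_le] degree_pderiv_mult_le)
        auto
    have "degree F \<le> t"
    proof (cases "k = p")
      case True
      have s: "i + j + k = Suc (t + 1)" using ij True by simp
      have "coeff F (t + 1) = (\<beta> * (real i + real j) - \<alpha> * real k)
          * (lead_coeff a * lead_coeff b * lead_coeff c)"
        unfolding F_def coeff_diff coeff_add coeff_smult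
        using s coeff_pderiv_mult_top[of a b c "t + 1"] coeff_pderiv_mult_top[of b a c "t + 1"]
          coeff_pderiv_mult_top[of c a b "t + 1"]
        by (simp add: algebra_simps)
      \<comment> \<open>This fixes the weights: both products equal
        \<open>p * (t - p + 2) / (t + 2)\<close>.\<close>
      also have "\<beta> * (real i + real j) - \<alpha> * real k = 0"
      proof -
        have "real i + real j = real t - real p + 2" using ij by linarith
        then show ?thesis using True by (simp add: \<alpha>_def \<beta>_def)
      qed
      finally have "coeff F (t + 1) = 0" by simp
      moreover have "degree F \<le> t + 1" using s by (intro degF) simp
      ultimately show ?thesis
        by (metis Suc_eq_plus1 degree_0 le_SucE leading_coeff_0_iff zero_le)
    next
      case False
      then show ?thesis using ij le by (intro degF) simp
    qed
    then have "int_dom F = int_dom (P F)"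
      using Q by (simp add: quadrature_strength_def P_def)
    then show ?thesis using GP by simp
  qed
  moreover have "aliasing_error X \<alpha> \<beta> i j k
      = int_dom (pderiv c * a * b) - \<beta> * int_bd (a * b * c) + int_dom G"
    by (simp add: aliasing_error_def Let_def G_def P_def a_def b_def c_def)
  ultimately have "aliasing_error X \<alpha> \<beta> i j k = 0"
    using no_aliasing_error[OF \<alpha>\<beta>, of c a b] by (simp add: F_def)
  then show ?thesis by (simp add: \<alpha>_def \<beta>_def)
qed

theorem corollary1:
  fixes p :: nat
  shows
    "(\<forall>q \<tau> X i j k.
        valid_collocation p q \<tau> X \<longrightarrow>
        p + q \<le> \<tau> + 1 \<or> 2 * p \<le> q \<longrightarrow>
        i \<le> p \<longrightarrow> j \<le> p \<longrightarrow> k \<le> p \<longrightarrow>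
        int i + int j = int \<tau> - int p + 2 \<longrightarrow>
        aliasing_error X ((real \<tau> - real p + 2) / (real \<tau> + 2)) (real p / (real \<tau> + 2)) i j k = 0)
     \<and> valid_collocation p p (2 * p + 1) (gauss_legendre_nodes p)
     \<and> (\<forall>i j k.
          i \<le> p \<longrightarrow> j \<le> p \<longrightarrow> k \<le> p \<longrightarrow> i + j = p + 3 \<longrightarrow>
          aliasing_error (gauss_legendre_nodes p)
            ((real p + 3) / (2 * real p + 3)) (real p / (2 * real p + 3)) i j k = 0)
     \<and> (p \<ge> 1 \<longrightarrow>
          valid_collocation p p (2 * p - 1) (gauss_lobatto_nodes p)
          \<and> (\<forall>i j k.
               i \<le> p \<longrightarrow> j \<le> p \<longrightarrow> k \<le> p \<longrightarrow> i + j = p + 1 \<longrightarrow>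
               aliasing_error (gauss_lobatto_nodes p)
                 ((real p + 1) / (2 * real p + 1)) (real p / (2 * real p + 1)) i j k = 0))"
proof (intro conjI impI allI)
  fix q \<tau> i j k :: nat and X
  assume "valid_collocation p q \<tau> X" "p + q \<le> \<tau> + 1 \<or> 2 * p \<le> q" "i \<le> p" "j \<le> p" "k \<le> p"
    and "int i + int j = int \<tau> - int p + 2"
  then show "aliasing_error X ((real \<tau> - real p + 2) / (real \<tau> + 2)) (real p / (real \<tau> + 2)) i j k = 0"
    by (intro aliasing_error_eq_0) auto
next
  show "valid_collocation p p (2 * p + 1) (gauss_legendre_nodes p)"
    by (rule valid_gauss_legendre)
next
  fix i j k assume "i \<le> p" "j \<le> p" "k \<le> p" "i + j = p + 3"
  then show "aliasing_error (gauss_legendre_nodes p)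
      ((real p + 3) / (2 * real p + 3)) (real p / (2 * real p + 3)) i j k = 0"
    \<comment> \<open>With \<open>t = 2 * p + 1\<close>, \<open>t - p + 2\<close> is
      \<open>p + 3\<close> and \<open>t + 2\<close> is \<open>2 * p + 3\<close>.\<close>
    using aliasing_error_eq_0[OF valid_gauss_legendre, of p i j k] by (simp add: algebra_simps)
next
  assume "p \<ge> 1"
  then show "valid_collocation p p (2 * p - 1) (gauss_lobatto_nodes p)"
    by (rule valid_gauss_lobatto)
next
  fix i j k assume p: "p \<ge> 1" and "i \<le> p" "j \<le> p" "k \<le> p" "i + j = p + 1"
  then show "aliasing_error (gauss_lobatto_nodes p)
      ((real p + 1) / (2 * real p + 1)) (real p / (2 * real p + 1)) i j k = 0"
    \<comment> \<open>Here \<open>q = p\<close> and \<open>t = 2 * p - 1\<close>, so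
      \<open>p + q <= t + 1\<close> holds with equality; \<open>p >= 1\<close> makes the natural
      subtraction exact.\<close>
    using aliasing_error_eq_0[OF valid_gauss_lobatto[OF p], of i j k]
    by (simp add: algebra_simps of_nat_diff)
qed

end
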